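(* Let $\rho_{AB}$ be a two-qubit state with vanishing local Bloch vectors, $\boldsymbol a=\boldsymbol b=0$, and arbitrary (not necessarily diagonal) correlation matrix $T$. Then for every choice of the auxiliary reference direction (unit vector) $\boldsymbol n_B\in\mathbb R^3$, $$\mathcal R_{KD}(\rho_{AB})=\mathcal C_{KD}(\rho_{AB}).$$
   Context: A two-qubit state is written $\rho_{AB}=\tfrac14\big[\mathbb I\otimes\mathbb I+\boldsymbol a\cdot\boldsymbol\sigma\otimes\mathbb I+\mathbb I\otimes\boldsymbol b\cdot\boldsymbol\sigma+\sum_{i,j=1}^3T_{ij}\,\sigma_i\otimes\sigma_j\big]$. Since $\boldsymbol b=0$ the reduced state of Bob is $\mathbb I/2$ and the KD reference basis is specified externally by a fixed unit vector $\boldsymbol n_B$, independent of $\rho_{AB}$. KD nonclassicality: let $\Pi_0,\Pi_1$ be the eigenprojectors of $\boldsymbol n_B\cdot\boldsymbol\sigma$. For an orthonormal qubit basis $\{|b_k\rangle\}_{k=0,1}$ and a qubit state $\rho$, put $Q_{ik}(\rho)=\mathrm{Tr}(|b_k\rangle\langle b_k|\,\Pi_i\,\rho)$, and define $\mathcal N_{KD}(\rho)=\max_{\{|b_k\rangle\}}\tfrac12\big(\sum_{i,k}|Q_{ik}(\rho)|-1\big)$ over all orthonormal qubit bases. For a POVM $\{M_a\}$ on Alice's qubit, $p(a)=\mathrm{Tr}[(M_a\otimes\mathbb I)\rho_{AB}]$ and, if $p(a)>0$, $\rho_{B|a}=\mathrm{Tr}_A[(M_a\otimes\mathbb I)\rho_{AB}]/p(a)$.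 Then $\mathcal R_{KD}(\rho_{AB})=\max_{\{M_a\},a}\mathcal N_{KD}(\rho_{B|a})$ (all POVMs, all outcomes of nonzero probability) and $\mathcal C_{KD}(\rho_{AB})=\max_{\{M_a\}}\sum_ap(a)\,\mathcal N_{KD}(\rho_{B|a})$ (all POVMs). *)

theory Defs
  imports "HOL-Analysis.Analysis"
begin

section \<open>Complex matrices\<close>

definition cinner :: "complex^'n \<Rightarrow> complex^'n \<Rightarrow> complex" where
  "cinner v w = (\<Sum>i\<in>UNIV. cnj (v $ i) * w $ i)"

definition ketbra :: "complex^'n \<Rightarrow> complex^'n \<Rightarrow> complex^'n^'n" where
  "ketbra v w = (\<chi> i j. v $ i * cnj (w $ j))"

definition dagger :: "complex^'n^'m \<Rightarrow> complex^'m^'n" where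
  "dagger A = (\<chi> i j. cnj (A $ j $ i))"

definition hermitian :: "complex^'n^'n \<Rightarrow> bool" where
  "hermitian A \<longleftrightarrow> dagger A = A"

definition psd :: "complex^'n^'n \<Rightarrow> bool" where
  "psd A \<longleftrightarrow> hermitian A \<and> (\<forall>v. 0 \<le> Re (cinner v (A *v v)))"

definition density_matrix :: "complex^'n^'n \<Rightarrow> bool" where
  "density_matrix \<rho> \<longleftrightarrow> psd \<rho> \<and> trace \<rho> = 1"

definition kron :: "complex^'n^'n \<Rightarrow> complex^'m^'m \<Rightarrow> complex^('n \<times> 'm)^('n \<times> 'm)" where
  "kron A B = (\<chi> i j. A $ fst i $ fst j * B $ snd i $ snd j)"

definition ptrace_fst :: "complex^('n::finite \<times> 'm::finite)^('n \<times> 'm) \<Rightarrow> complex^'m^'m" where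
  "ptrace_fst X = (\<chi> i j. \<Sum>k\<in>UNIV. X $ (k, i) $ (k, j))"

text \<open>The orthogonal projector onto the eigenspace of \<open>A\<close> for the eigenvalue \<open>c\<close>.\<close>

definition eigenprojector :: "complex^'n^'n \<Rightarrow> complex \<Rightarrow> complex^'n^'n" where
  "eigenprojector A c =
     (THE P. hermitian P \<and> P ** P = P \<and> range ((*v) P) = {v. A *v v = c *s v})"


lemma dagger_mult: "dagger (A ** B) = dagger B ** dagger A"
  by (simp add: dagger_def matrix_matrix_mult_def vec_eq_iff mult.commute)

lemma eigenprojector_eqI:
  assumes "hermitian P" "P ** P = P" "range ((*v) P) = {v. A *v v = c *s v}"
  shows "eigenprojector A c = P"
  unfolding eigenprojector_def
proof (rule the_equality)
  fix Q assume Q: "hermitian Q \<and> Q ** Q = Q \<and> range ((*v) Q) = {v. A *v v = c *s v}"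
  have absorb: "X ** Y = Y"
    if "X ** X = X" "range ((*v) X) = range ((*v) Y)" for X Y :: "complex^'a^'a"
  proof -
    have "(X ** Y) *v v = Y *v v" for v
    proof -
      have "Y *v v \<in> range ((*v) X)" using that(2) by simp
      then obtain w where w: "Y *v v = X *v w" by auto
      have "(X ** Y) *v v = X *v (X *v w)" by (simp only: matrix_vector_mul_assoc[symmetric] w)
      also have "\<dots> = Y *v v" by (simp only: matrix_vector_mul_assoc that(1) w)
      finally show ?thesis .
    qed
    then show ?thesis unfolding matrix_eq by blast
  qed
  have PQ: "P ** Q = Q" and QP: "Q ** P = P"
    using absorb[of P Q] absorb[of Q P] Q assms(2,3) by simp_all
  have "dagger (P ** Q) = Q ** P"
    using Q assms(1) by (simp only: dagger_mult hermitian_def)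
  then show "Q = P" using Q by (simp only: PQ QP hermitian_def)
qed (use assms in blast)

section \<open>Qubits\<close>

definition pauli :: "complex^2^2^3" where
  "pauli = vector
     [vector [vector [0, 1], vector [1, 0]],
      vector [vector [0, - \<i>], vector [\<i>, 0]],
      vector [vector [1, 0], vector [0, - 1]]]"

definition dot_sigma :: "real^3 \<Rightarrow> complex^2^2" where
  "dot_sigma r = (\<Sum>i\<in>UNIV. r $ i *\<^sub>R pauli $ i)"

definition two_qubit :: "real^3 \<Rightarrow> real^3 \<Rightarrow> real^3^3 \<Rightarrow> complex^(2 \<times> 2)^(2 \<times> 2)" where
  "two_qubit a b T = (1/4) *\<^sub>R
     (kron (mat 1) (mat 1) + kron (dot_sigma a) (mat 1) + kron (mat 1) (dot_sigma b)
      + (\<Sum>i\<in>UNIV. \<Sum>j\<in>UNIV. T $ i $ j *\<^sub>R kron (pauli $ i) (pauli $ j)))"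


lemma dot_sigma_eq:
  "dot_sigma r = vector [vector [of_real (r $ 3), of_real (r $ 1) - \<i> * of_real (r $ 2)],
                         vector [of_real (r $ 1) + \<i> * of_real (r $ 2), - of_real (r $ 3)]]"
  by (simp add: dot_sigma_def pauli_def vec_eq_iff sum_3 forall_2
      scaleR_conv_of_real[where 'a=complex] mult.commute)

lemma dot_sigma_square:
  assumes "norm r = 1"
  shows "dot_sigma r ** dot_sigma r = mat 1"
proof -
  have "(r $ 1)\<^sup>2 + (r $ 2)\<^sup>2 + (r $ 3)\<^sup>2 = 1"
    using assms by (simp add: norm_vec_def L2_set_def sum_3)
  then have "complex_of_real ((r $ 1)\<^sup>2 + (r $ 2)\<^sup>2 + (r $ 3)\<^sup>2) = 1" by simp
  then show ?thesis
    by (simp add: dot_sigma_eq matrix_matrix_mult_def vec_eq_iff sum_2 forall_2 mat_def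
        algebra_simps power2_eq_square)
qed

section \<open>Kirkwood--Dirac nonclassicality\<close>

text \<open>The labels \<open>0, 1\<close> of eigenprojectors and basis vectors are the two elements of type \<open>2\<close>.\<close>

definition ref_proj :: "real^3 \<Rightarrow> 2 \<Rightarrow> complex^2^2" where
  "ref_proj n i = eigenprojector (dot_sigma n) (if i = 0 then 1 else - 1)"

lemma ref_proj_eq:
  assumes "norm n = 1"
  shows "ref_proj n i = (1/2) *\<^sub>R (mat 1 + (if i = 0 then 1 else - 1) *\<^sub>R dot_sigma n)"
proof -
  define s :: real where "s = (if i = 0 then 1 else - 1)"
  have ss: "s * s = 1" by (simp add: s_def)
  define S where "S = dot_sigma n"
  have SS: "S ** S = mat 1" using assms by (simp add: S_def dot_sigma_square)
  define P where "P = (1/2) *\<^sub>R (mat 1 + s *\<^sub>R S)"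
  have "dagger S = S"
    by (simp add: S_def dagger_def dot_sigma_eq vec_eq_iff forall_2)
  then have "cnj (S $ j $ i) = S $ i $ j" for i j
    by (simp add: dagger_def vec_eq_iff)
  then have herm: "hermitian P"
    by (simp add: P_def hermitian_def dagger_def vec_eq_iff mat_def)
  have Pv: "P *v v = (1/2) *\<^sub>R (v + s *\<^sub>R (S *v v))" for v
    by (simp add: P_def matrix_vector_mult_def mat_def vec_eq_iff sum_2 forall_2 algebra_simps)
  have Sr: "S *v (x *\<^sub>R v) = x *\<^sub>R (S *v v)" for x :: real and v
    by (simp add: matrix_vector_mult_def vec_eq_iff scaleR_sum_right)
  have SSv: "S *v (S *v v) = v" for v by (simp add: matrix_vector_mul_assoc SS)
  have SP: "S *v (P *v v) = s *\<^sub>R (P *v v)" for v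
  proof -
    have "S *v (P *v v) = (1/2) *\<^sub>R (S *v v + s *\<^sub>R v)"
      by (simp only: Pv Sr matrix_vector_right_distrib SSv)
    also have "\<dots> = (1/2) *\<^sub>R ((s * s) *\<^sub>R (S *v v) + s *\<^sub>R v)" by (simp only: ss scaleR_one)
    also have "\<dots> = s *\<^sub>R (P *v v)" by (simp add: Pv algebra_simps)
    finally show ?thesis .
  qed
  have fix_P: "P *v v = v" if "S *v v = s *\<^sub>R v" for v
  proof -
    have "P *v v = (1/2) *\<^sub>R (v + (s * s) *\<^sub>R v)" by (simp only: Pv that scaleR_scaleR)
    also have "\<dots> = v" unfolding ss scaleR_one by (simp flip: scaleR_2)
    finally show ?thesis .
  qed
  have idem: "P ** P = P"
    by (simp add: matrix_eq matrix_vector_mul_assoc[symmetric] fix_P SP)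
  have cs: "complex_of_real s *s v = s *\<^sub>R v" for v :: "complex^2"
    by (simp add: vec_eq_iff scaleR_conv_of_real[where 'a=complex])
  have "range ((*v) P) = {v. S *v v = complex_of_real s *s v}"
    unfolding cs
  proof (intro subset_antisym subsetI)
    fix v assume "v \<in> {v. S *v v = s *\<^sub>R v}"
    then have "v = P *v v" using fix_P by simp
    then show "v \<in> range ((*v) P)" by (rule range_eqI)
  next
    fix v assume "v \<in> range ((*v) P)"
    then obtain w where "v = P *v w" by blast
    then show "v \<in> {v. S *v v = s *\<^sub>R v}" using SP by simp
  qed
  then have "eigenprojector S (complex_of_real s) = P"
    using herm idem by (intro eigenprojector_eqI)
  then show ?thesis by (simp add: ref_proj_def P_def S_def s_def if_distrib cong: if_cong)
qed

definition onb :: "(2 \<Rightarrow> complex^2) \<Rightarrow> bool" where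
  "onb b \<longleftrightarrow> (\<forall>k l. cinner (b k) (b l) = (if k = l then 1 else 0))"

definition KD_quasi :: "real^3 \<Rightarrow> (2 \<Rightarrow> complex^2) \<Rightarrow> complex^2^2 \<Rightarrow> 2 \<Rightarrow> 2 \<Rightarrow> complex" where
  "KD_quasi n b \<rho> i k = trace (ketbra (b k) (b k) ** ref_proj n i ** \<rho>)"

text \<open>Here and below, maxima over all bases or all POVMs are rendered as suprema of sets of
  reals. These sets are nonempty and bounded for a unit vector \<open>n\<close> and density matrices, since
  every Kirkwood--Dirac entry then has modulus at most 1.\<close>

definition N_KD :: "real^3 \<Rightarrow> complex^2^2 \<Rightarrow> real" where
  "N_KD n \<rho> =
     Sup {((\<Sum>i\<in>UNIV. \<Sum>k\<in>UNIV. cmod (KD_quasi n b \<rho> i k)) - 1) / 2 | b. onb b}"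

lemma N_KD_attained:
  obtains b where "onb b"
    and "N_KD n \<rho> = ((\<Sum>i\<in>UNIV. \<Sum>k\<in>UNIV. cmod (KD_quasi n b \<rho> i k)) - 1) / 2"
    and "\<And>b'. onb b' \<Longrightarrow>
      ((\<Sum>i\<in>UNIV. \<Sum>k\<in>UNIV. cmod (KD_quasi n b' \<rho> i k)) - 1) / 2 \<le> N_KD n \<rho>"
proof -
  define f where "f b = ((\<Sum>i\<in>UNIV. \<Sum>k\<in>UNIV. cmod (KD_quasi n b \<rho> i k)) - 1) / 2" for b
  define K :: "(complex^2^2) set" where "K = {B. onb (($) B)}"
  have "onb (($) (mat 1 :: complex^2^2))"
    by (simp add: onb_def cinner_def mat_def sum_2 forall_2)
  then have ne: "K \<noteq> {}" by (auto simp: K_def)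
  have "closed K"
    unfolding K_def onb_def cinner_def
    by (intro closed_Collect_all closed_Collect_eq continuous_intros)
  moreover have "bounded K"
  proof (rule boundedI)
    fix B assume "B \<in> K"
    then have "norm (B $ k) = 1" for k
    proof -
      have "(\<Sum>i\<in>UNIV. cnj (B $ k $ i) * B $ k $ i) = 1"
        using \<open>B \<in> K\<close> by (simp add: K_def onb_def cinner_def)
      then have "complex_of_real (\<Sum>i\<in>UNIV. (cmod (B $ k $ i))\<^sup>2) = 1"
        by (simp only: of_real_sum complex_norm_square mult.commute)
      then have "(\<Sum>i\<in>UNIV. (cmod (B $ k $ i))\<^sup>2) = 1" using of_real_eq_1_iff by blast
      then show ?thesis by (simp add: norm_vec_def L2_set_def)
    qed
    then show "norm B \<le> sqrt 2" by (simp add: norm_vec_def[of B] L2_set_def)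
  qed
  ultimately have "compact K" by (simp add: compact_eq_bounded_closed)
  moreover have "continuous_on K (\<lambda>B. f (($) B))"
    unfolding f_def KD_quasi_def ketbra_def trace_def matrix_matrix_mult_def
    by (simp, intro continuous_intros) simp
  ultimately obtain B where B: "B \<in> K" "\<And>B'. B' \<in> K \<Longrightarrow> f (($) B') \<le> f (($) B)"
    using continuous_attains_sup ne by metis
  have max: "f b \<le> f (($) B)" if "onb b" for b
  proof -
    have "($) (\<chi> k. b k) = b" by (rule ext) simp
    then show ?thesis using B(2)[of "\<chi> k. b k"] that by (simp add: K_def)
  qed
  have "N_KD n \<rho> = f (($) B)"
    unfolding N_KD_def f_def[symmetric] using B(1) max by (intro cSup_eq_maximum) (auto simp: K_def)
  then show ?thesis using that[of "($) B"] B(1) max by (simp add: K_def f_def)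
qed


section \<open>Remote Kirkwood--Dirac nonclassicality\<close>

definition povm :: "nat \<Rightarrow> (nat \<Rightarrow> complex^2^2) \<Rightarrow> bool" where
  "povm m M \<longleftrightarrow> (\<forall>a<m. psd (M a)) \<and> (\<Sum>a<m. M a) = mat 1"

definition outcome_prob :: "complex^(2 \<times> 2)^(2 \<times> 2) \<Rightarrow> complex^2^2 \<Rightarrow> real" where
  "outcome_prob \<rho> E = Re (trace (kron E (mat 1) ** \<rho>))"

definition cond_state :: "complex^(2 \<times> 2)^(2 \<times> 2) \<Rightarrow> complex^2^2 \<Rightarrow> complex^2^2" where
  "cond_state \<rho> E = (1 / outcome_prob \<rho> E) *\<^sub>R ptrace_fst (kron E (mat 1) ** \<rho>)"

definition R_KD :: "real^3 \<Rightarrow> complex^(2 \<times> 2)^(2 \<times> 2) \<Rightarrow> real" where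
  "R_KD n \<rho> =
     Sup {N_KD n (cond_state \<rho> (M a)) | m M a. povm m M \<and> a < m \<and> outcome_prob \<rho> (M a) > 0}"

definition C_KD :: "real^3 \<Rightarrow> complex^(2 \<times> 2)^(2 \<times> 2) \<Rightarrow> real" where
  "C_KD n \<rho> =
     Sup {\<Sum>a\<in>{a. a < m \<and> outcome_prob \<rho> (M a) > 0}.
            outcome_prob \<rho> (M a) * N_KD n (cond_state \<rho> (M a)) | m M. povm m M}"

end

theory Submission
  imports Defs
begin

text \<open>Averaging over the outcomes of a POVM never beats the best outcome, so \<open>C_KD \<le> R_KD\<close>.
  For the converse, the spin flip \<open>A \<mapsto> (tr A) I - A\<close>, which is the \<open>2 \<times> 2\<close> adjugate and hence
  reverses products, negates Bloch vectors. It swaps the two elements of every orthonormal basis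
  and the two reference projectors, so it preserves \<open>N_KD\<close>. When both marginals are maximally
  mixed, flipping the effect on Alice's side flips the conditional state on Bob's side; the POVM
  proportional to an effect \<open>E\<close> and its flip therefore has average \<open>N_KD\<close> equal to that of the state
  conditioned on \<open>E\<close>.\<close>

section \<open>Spin flip and invariance of Kirkwood-Dirac nonclassicality\<close>

text \<open>Labels live in arithmetic modulo 2, so \<open>k + 1\<close> is the other label; at
  \<open>k = 2\<close> it simplifies to the numeral \<open>3\<close>.\<close>

lemma three_eq_one_2: "(3 :: 2) = 1"
  by simp

definition spin_flip :: "complex^2^2 \<Rightarrow> complex^2^2" where
  "spin_flip A = mat (trace A) - A"

lemma trace_spin_flip: "trace (spin_flip A) = trace A"
  by (simp add: spin_flip_def trace_def mat_def sum_2)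

text \<open>The three adjugates multiply to the adjugate of \<open>C ** B ** A\<close>, and a 2 by 2
  adjugate keeps the trace.\<close>

lemma trace_spin_flip_mult:
  "trace (spin_flip A ** spin_flip B ** spin_flip C) = trace (C ** B ** A)"
  by (simp add: spin_flip_def trace_def mat_def matrix_matrix_mult_def sum_2 algebra_simps)

lemma hermitian_nth:
  assumes "hermitian A"
  shows "cnj (A $ j $ i) = A $ i $ j"
proof -
  have "dagger A $ i $ j = A $ i $ j"
    using assms by (simp add: hermitian_def)
  then show ?thesis by (simp add: dagger_def)
qed

text \<open>Taking adjoints also reverses a product, which undoes the reversal caused by the flip at
  the price of a conjugation.\<close>

lemma trace_hermitian_mult:
  assumes "hermitian A" "hermitian B" "hermitian C"
  shows "trace (C ** B ** A) = cnj (trace (A ** B ** C))"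
proof -
  have "dagger (A ** B ** C) = C ** B ** A"
    using assms by (simp add: dagger_mult hermitian_def matrix_mul_assoc)
  moreover have "trace (dagger X) = cnj (trace X)" for X :: "complex^'n^'n"
    by (simp add: dagger_def trace_def)
  ultimately show ?thesis by metis
qed

lemma hermitian_ketbra: "hermitian (ketbra v v)"
  by (simp add: hermitian_def ketbra_def dagger_def vec_eq_iff mult.commute)

lemma spin_flip_ketbra:
  assumes "onb b"
  shows "spin_flip (ketbra (b k) (b k)) = ketbra (b (k + 1)) (b (k + 1))"
proof -
  define B where "B = (\<chi> k i. cnj (b k $ i))"
  have "B ** dagger B = mat 1"
    using assms by (simp add: B_def dagger_def matrix_matrix_mult_def onb_def cinner_def
        vec_eq_iff mat_def)
  \<comment> \<open>For a square matrix a right inverse is a left inverse; this turns orthonormality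
    of the basis into completeness.\<close>
  then have "dagger B ** B = mat 1"
    using matrix_left_right_inverse by blast
  then have "(\<Sum>k\<in>UNIV. b k $ i * cnj (b k $ j)) = (if i = j then 1 else 0)" for i j
    by (simp add: B_def dagger_def matrix_matrix_mult_def vec_eq_iff mat_def)
  then have "ketbra (b 1) (b 1) + ketbra (b 2) (b 2) = mat 1"
    by (simp add: ketbra_def vec_eq_iff mat_def sum_2)
  moreover have "trace (ketbra (b l) (b l)) = 1" for l
    using assms by (simp add: ketbra_def trace_def onb_def cinner_def mult.commute)
  ultimately show ?thesis
    using exhaust_2[of k] by (auto simp: spin_flip_def three_eq_one_2 algebra_simps)
qed

lemma hermitian_ref_proj:
  assumes "norm n = 1"
  shows "hermitian (ref_proj n i)"
  by (simp add: ref_proj_eq[OF assms] hermitian_def dagger_def dot_sigma_eq vec_eq_iff forall_2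
      mat_def)

lemma spin_flip_ref_proj:
  assumes "norm n = 1"
  shows "spin_flip (ref_proj n i) = ref_proj n (i + 1)"
  using exhaust_2[of i]
  by (auto simp: ref_proj_eq[OF assms] spin_flip_def dot_sigma_eq vec_eq_iff forall_2
      mat_def trace_def sum_2 scaleR_conv_of_real[where 'a=complex] diff_divide_distrib
      add_divide_distrib)

text \<open>Shifting both labels amounts to flipping all three factors under the trace. The
  conjugation is harmless because \<open>N_KD\<close> sees only moduli.\<close>

lemma KD_quasi_spin_flip:
  assumes "norm n = 1" "onb b" "hermitian \<rho>"
  shows "KD_quasi n b (spin_flip \<rho>) (i + 1) (k + 1) = cnj (KD_quasi n b \<rho> i k)"
proof -
  have "KD_quasi n b (spin_flip \<rho>) (i + 1) (k + 1) =
      trace (spin_flip (ketbra (b k) (b k)) ** spin_flip (ref_proj n i) ** spin_flip \<rho>)"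
    by (simp add: KD_quasi_def spin_flip_ketbra[OF assms(2)] spin_flip_ref_proj[OF assms(1)])
  also have "\<dots> = cnj (KD_quasi n b \<rho> i k)"
    unfolding KD_quasi_def trace_spin_flip_mult
    by (rule trace_hermitian_mult[OF hermitian_ketbra hermitian_ref_proj[OF assms(1)] assms(3)])
  finally show ?thesis .
qed

lemma N_KD_spin_flip:
  assumes "norm n = 1" "hermitian \<rho>"
  shows "N_KD n (spin_flip \<rho>) = N_KD n \<rho>"
proof -
  have "(\<Sum>i\<in>UNIV. \<Sum>k\<in>UNIV. cmod (KD_quasi n b (spin_flip \<rho>) i k)) =
      (\<Sum>i\<in>UNIV. \<Sum>k\<in>UNIV. cmod (KD_quasi n b \<rho> i k))" if "onb b" for b
  proof -
    have "cmod (KD_quasi n b (spin_flip \<rho>) (i + 1) (k + 1)) = cmod (KD_quasi n b \<rho> i k)" for i k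
      by (simp add: KD_quasi_spin_flip[OF assms(1) that assms(2)])
    from this[of 1 1] this[of 1 2] this[of 2 1] this[of 2 2] show ?thesis
      by (simp add: sum_2 three_eq_one_2)
  qed
  \<comment> \<open>The sums agree only for orthonormal \<open>b\<close>;
    \<open>rev_conj_cong\<close> makes \<open>onb b\<close> available while the value in the set is
    rewritten.\<close>
  then show ?thesis
    unfolding N_KD_def by (simp cong: rev_conj_cong)
qed

section \<open>Bounding nonclassicality by the norm of the state\<close>

lemma norm_entry_le: "norm (A $ i $ j) \<le> norm A"
  using Finite_Cartesian_Product.norm_nth_le[of "A $ i" j]
    Finite_Cartesian_Product.norm_nth_le[of A i] by linarith

text \<open>The trace is a sum over three indices, and each term is at most the product of the
  norms.\<close>

lemma norm_trace_mult_le: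
  fixes A B C :: "complex^'n^'n"
  shows "cmod (trace (A ** B ** C)) \<le> real CARD('n) ^ 3 * (norm A * norm B * norm C)"
proof -
  have "cmod (trace (A ** B ** C)) =
      cmod (\<Sum>i\<in>UNIV. \<Sum>k\<in>UNIV. \<Sum>j\<in>UNIV. A $ i $ j * B $ j $ k * C $ k $ i)"
    by (simp add: trace_def matrix_matrix_mult_def sum_distrib_right)
  also have "\<dots> \<le> (\<Sum>i\<in>(UNIV::'n set). \<Sum>k\<in>(UNIV::'n set). \<Sum>j\<in>(UNIV::'n set).
      norm A * norm B * norm C)"
    by (intro sum_norm_le) (simp add: norm_mult mult_mono norm_entry_le)
  also have "\<dots> = real CARD('n) ^ 3 * (norm A * norm B * norm C)"
    by (simp add: power3_eq_cube)
  finally show ?thesis .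
qed

lemma norm_vec_le_sum: "norm x \<le> (\<Sum>i\<in>UNIV. norm (x $ i))"
  by (simp add: norm_vec_def L2_set_le_sum)

lemma norm_ketbra_le:
  assumes "onb b"
  shows "norm (ketbra (b k) (b k)) \<le> 4"
proof -
  have "complex_of_real (\<Sum>i\<in>UNIV. (cmod (b k $ i))\<^sup>2) = 1"
    using assms by (simp only: of_real_sum complex_norm_square mult.commute onb_def cinner_def) simp
  then have "norm (b k) = 1"
    by (simp add: norm_vec_def L2_set_def flip: of_real_sum)
  then have 1: "cmod (b k $ i) \<le> 1" for i
    by (metis Finite_Cartesian_Product.norm_nth_le)
  have "norm (ketbra (b k) (b k)) \<le> (\<Sum>i\<in>UNIV. norm (ketbra (b k) (b k) $ i))"
    by (rule norm_vec_le_sum)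
  also have "\<dots> \<le> (\<Sum>i\<in>(UNIV::2 set). \<Sum>j\<in>(UNIV::2 set). 1)"
    by (intro sum_mono order.trans[OF norm_vec_le_sum])
      (simp add: ketbra_def norm_mult mult_le_one 1)
  finally show ?thesis by simp
qed

text \<open>Serves to bound the set behind \<open>R_KD\<close>, without which its \<open>Sup\<close>
  would carry no information. Crude constants suffice.\<close>

lemma N_KD_le_norm:
  obtains K where "0 \<le> K" "\<And>\<rho>. N_KD n \<rho> \<le> K * norm \<rho>"
proof
  define P where "P = norm (ref_proj n 1) + norm (ref_proj n 2)"
  \<comment> \<open>Each entry is at most \<open>2 ^ 3 * 4 * P * norm \<rho>\<close>; four entries,
    halved, give the factor 64.\<close>
  show "0 \<le> 64 * P" by (simp add: P_def)
  fix \<rho>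
  obtain b where b: "onb b"
    and eq: "N_KD n \<rho> = ((\<Sum>i\<in>UNIV. \<Sum>k\<in>UNIV. cmod (KD_quasi n b \<rho> i k)) - 1) / 2"
    using N_KD_attained by blast
  have "cmod (KD_quasi n b \<rho> i k) \<le> 32 * P * norm \<rho>" for i k
  proof -
    have "norm (ref_proj n i) \<le> P"
      using exhaust_2[of i] by (auto simp: P_def)
    then have "norm (ketbra (b k) (b k)) * norm (ref_proj n i) * norm \<rho> \<le> 4 * P * norm \<rho>"
      by (intro mult_mono norm_ketbra_le b) (auto simp: P_def)
    then show ?thesis
      using norm_trace_mult_le[of "ketbra (b k) (b k)" "ref_proj n i" \<rho>]
      by (simp add: KD_quasi_def)
  qed
  then have "(\<Sum>i\<in>UNIV. \<Sum>k\<in>UNIV. cmod (KD_quasi n b \<rho> i k)) \<le>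
      (\<Sum>i\<in>(UNIV::2 set). \<Sum>k\<in>(UNIV::2 set). 32 * P * norm \<rho>)"
    by (intro sum_mono)
  then show "N_KD n \<rho> \<le> 64 * P * norm \<rho>" by (simp add: eq)
qed

section \<open>Positive semidefinite qubit matrices\<close>

text \<open>The quadratic form at the standard basis vectors controls the diagonal, and at a vector
  \<open>(1, u)\<close> with a suitable phase \<open>u\<close> the off-diagonal entry.\<close>

lemma psd_qubit_entries:
  fixes E :: "complex^2^2"
  assumes "psd E"
  shows "cmod (E $ i $ j) \<le> Re (trace E)" "E $ i $ i = of_real (Re (E $ i $ i))"
    "0 \<le> Re (E $ i $ i)"
proof -
  have h: "cnj (E $ j $ i) = E $ i $ j" for i j
    using assms by (simp add: psd_def hermitian_nth)
  show real: "E $ i $ i = of_real (Re (E $ i $ i))" for i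
    using h[of i i] by (simp add: complex_eq_iff)
  have quad: "0 \<le> Re (cnj x * (E$1$1 * x + E$1$2 * y) + cnj y * (E$2$1 * x + E$2$2 * y))" for x y
  proof -
    have "0 \<le> Re (cinner (vector [x, y]) (E *v vector [x, y]))"
      using assms by (simp add: psd_def)
    then show ?thesis by (simp add: cinner_def matrix_vector_mult_def sum_2)
  qed
  show pos: "0 \<le> Re (E $ i $ i)" for i
    using quad[of 1 0] quad[of 0 1] exhaust_2[of i] by auto
  define c where "c = E $ 1 $ 2"
  have off: "cmod c \<le> Re (trace E)"
  proof (cases "c = 0")
    case True
    then show ?thesis using pos[of 1] pos[of 2] by (simp add: trace_def sum_2)
  next
    case False
    \<comment> \<open>The phase that makes \<open>c * u\<close> equal to \<open>- cmod c\<close>,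
      hence the quadratic form at \<open>(1, u)\<close> as small as possible.\<close>
    define u where "u = - cnj c / of_real (cmod c)"
    have cu: "c * u = - of_real (cmod c)"
      using False by (simp add: u_def complex_norm_square[symmetric] field_simps)
        (simp add: power2_eq_square)
    have uu: "cnj u * u = 1"
      using False by (simp add: u_def complex_norm_square[symmetric] field_simps)
        (simp add: power2_eq_square)
    have "E$2$1 = cnj c" by (simp add: c_def h)
    then have "cnj 1 * (E$1$1 * 1 + E$1$2 * u) + cnj u * (E$2$1 * 1 + E$2$2 * u) =
        E$1$1 + c * u + cnj (c * u) + E$2$2 * (cnj u * u)"
      by (simp add: c_def algebra_simps)
    then have "0 \<le> Re (E$1$1) - 2 * cmod c + Re (E$2$2)"
      using quad[of 1 u] by (simp only: cu uu) simp
    then have "2 * cmod c \<le> Re (trace E)"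
      by (simp add: trace_def sum_2)
    then show ?thesis
      using norm_ge_zero[of c] by linarith
  qed
  have d: "cmod (E $ i $ i) = Re (E $ i $ i)" for i
    using real[of i] pos[of i] by (metis abs_of_nonneg norm_of_real)
  have "E$2$1 = cnj c" by (simp add: c_def h)
  then have "cmod (E$2$1) = cmod c" by simp
  then show "cmod (E $ i $ j) \<le> Re (trace E)"
    using off pos[of 1] pos[of 2] exhaust_2[of i] exhaust_2[of j] d[of 1] d[of 2]
    by (auto simp: c_def[symmetric] trace_def sum_2)
qed

lemma norm_psd_le:
  fixes E :: "complex^2^2"
  assumes "psd E"
  shows "norm E \<le> 4 * Re (trace E)"
proof -
  have "norm E \<le> (\<Sum>i\<in>UNIV. norm (E $ i))"
    by (rule norm_vec_le_sum)
  also have "\<dots> \<le> (\<Sum>i\<in>(UNIV::2 set). \<Sum>j\<in>(UNIV::2 set). Re (trace E))"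
    by (intro sum_mono order.trans[OF norm_vec_le_sum] psd_qubit_entries assms)
  finally show ?thesis by simp
qed

lemma psd_trace:
  fixes E :: "complex^2^2"
  assumes "psd E"
  shows "0 \<le> Re (trace E)" "trace E = of_real (Re (trace E))"
  using psd_qubit_entries(1)[OF assms, of 1 1] norm_ge_zero[of "E $ 1 $ 1"]
    psd_qubit_entries(2)[OF assms, of 1] psd_qubit_entries(2)[OF assms, of 2]
  by (linarith, simp add: trace_def sum_2 complex_eq_iff)

lemma psd_scaleR:
  fixes E :: "complex^'n^'n"
  assumes "psd E" "0 \<le> c"
  shows "psd (c *\<^sub>R E)"
proof -
  have "cinner v ((c *\<^sub>R E) *v v) = c *\<^sub>R cinner v (E *v v)" for v
    by (simp add: cinner_def matrix_vector_mult_def scaleR_sum_right sum_distrib_left)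
  then show ?thesis
    using assms by (simp add: psd_def hermitian_def dagger_def vec_eq_iff)
qed

lemma psd_spin_flip:
  assumes "psd E"
  shows "psd (spin_flip E)"
proof -
  have h: "cnj (E $ j $ i) = E $ i $ j" for i j
    using assms by (simp add: psd_def hermitian_nth)
  have "hermitian (spin_flip E)"
    by (simp add: hermitian_def dagger_def spin_flip_def vec_eq_iff mat_def trace_def h)
  \<comment> \<open>The vector on the right is the time reversal of \<open>v\<close>, which is
    orthogonal to \<open>v\<close>; positivity of \<open>E\<close> there is positivity of the flip
    at \<open>v\<close>.\<close>
  moreover have "cinner v (spin_flip E *v v) =
      cinner (vector [- cnj (v$2), cnj (v$1)]) (E *v vector [- cnj (v$2), cnj (v$1)])" for v
    by (simp add: cinner_def matrix_vector_mult_def sum_2 spin_flip_def mat_def trace_def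
        algebra_simps)
  ultimately show ?thesis
    using assms by (simp add: psd_def)
qed

section \<open>Partial traces and conditional states\<close>

text \<open>The identity factor collapses the sum over Bob's index. Linearity in \<open>E\<close>,
  hermiticity and the effect of the flip are read off from this formula.\<close>

lemma ptrace_fst_kron_mult:
  "ptrace_fst (kron E (mat 1) ** \<rho>) $ i $ j = (\<Sum>k\<in>UNIV. \<Sum>l\<in>UNIV. E $ k $ l * \<rho> $ (l, i) $ (k, j))"
proof -
  have "(\<Sum>x\<in>UNIV. kron E (mat 1) $ (k, i) $ x * \<rho> $ x $ (k, j)) =
      (\<Sum>l\<in>UNIV. E $ k $ l * \<rho> $ (l, i) $ (k, j))" for k
  proof -
    have "(\<Sum>x\<in>UNIV. kron E (mat 1) $ (k, i) $ x * \<rho> $ x $ (k, j)) =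
      (\<Sum>l\<in>UNIV. \<Sum>m\<in>UNIV. kron E (mat 1) $ (k, i) $ (l, m) * \<rho> $ (l, m) $ (k, j))"
      by (simp add: sum.cartesian_product flip: UNIV_Times_UNIV)
    also have "\<dots> = (\<Sum>l\<in>UNIV. \<Sum>m\<in>UNIV. if i = m then E $ k $ l * \<rho> $ (l, m) $ (k, j) else 0)"
      by (intro sum.cong) (auto simp: kron_def mat_def)
    finally show ?thesis by simp
  qed
  then show ?thesis by (simp add: ptrace_fst_def matrix_matrix_mult_def)
qed

lemma trace_ptrace_fst: "trace (ptrace_fst X) = trace X"
proof -
  have "trace (ptrace_fst X) = (\<Sum>k\<in>UNIV. \<Sum>i\<in>UNIV. X $ (k, i) $ (k, i))"
    by (simp add: trace_def ptrace_fst_def) (rule sum.swap)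
  then show ?thesis
    by (simp add: trace_def sum.cartesian_product case_prod_unfold flip: UNIV_Times_UNIV)
qed

lemma linear_ptrace_fst_kron: "linear (\<lambda>E. ptrace_fst (kron E (mat 1) ** \<rho>))"
  by (rule linearI)
    (simp_all add: vec_eq_iff ptrace_fst_kron_mult algebra_simps sum.distrib scaleR_sum_right)

text \<open>Conjugation exchanges the two summation indices of Alice's qubit, so swapping the sums
  restores the entry.\<close>

lemma hermitian_ptrace_fst_kron:
  assumes "hermitian E" "hermitian \<rho>"
  shows "hermitian (ptrace_fst (kron E (mat 1) ** \<rho>))"
  by (simp add: hermitian_def dagger_def vec_eq_iff ptrace_fst_kron_mult
      hermitian_nth[OF assms(1)] hermitian_nth[OF assms(2)]) (intro allI sum.swap)

lemma outcome_prob_ptrace: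
  "outcome_prob \<rho> E = Re (trace (ptrace_fst (kron E (mat 1) ** \<rho>)))"
  by (simp add: outcome_prob_def trace_ptrace_fst)

lemma outcome_prob_scaleR: "outcome_prob \<rho> (c *\<^sub>R E) = c * outcome_prob \<rho> E"
  by (simp add: outcome_prob_ptrace linear_cmul[OF linear_ptrace_fst_kron])
    (simp add: trace_def scaleR_sum_right flip: sum_distrib_left)

text \<open>Numerator and probability scale alike, so an effect can be rescaled to fit into a
  POVM.\<close>

lemma cond_state_scaleR:
  assumes "0 < c"
  shows "cond_state \<rho> (c *\<^sub>R E) = cond_state \<rho> E"
  using assms by (simp add: cond_state_def outcome_prob_scaleR linear_cmul[OF linear_ptrace_fst_kron])

lemma hermitian_cond_state:
  assumes "hermitian E" "hermitian \<rho>"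
  shows "hermitian (cond_state \<rho> E)"
  using hermitian_ptrace_fst_kron[OF assms]
  by (simp add: cond_state_def hermitian_def dagger_def vec_eq_iff)

lemma spin_flip_scaleR: "spin_flip (c *\<^sub>R A) = c *\<^sub>R spin_flip A"
  by (simp add: spin_flip_def trace_def mat_def vec_eq_iff scaleR_diff_right flip: scaleR_sum_right)

section \<open>Two-qubit states with maximally mixed marginals\<close>

lemma two_qubit_0_nth:
  "two_qubit 0 0 T $ (k, i) $ (l, j) = (mat 1 $ k $ l * mat 1 $ i $ j
    + (\<Sum>a\<in>UNIV. \<Sum>b\<in>UNIV. of_real (T $ a $ b) * (pauli $ a $ k $ l * pauli $ b $ i $ j))) / 4"
  by (simp add: two_qubit_def dot_sigma_def kron_def sum_3 scaleR_conv_of_real[where 'a=complex]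
      add_divide_distrib)

lemma pauli_trace: "pauli $ a $ 1 $ 1 + pauli $ a $ 2 $ 2 = 0"
  using exhaust_3[of a] by (auto simp: pauli_def)

text \<open>This is Bob's marginal: tracelessness of Alice's Pauli factor removes every correlation
  term.\<close>

lemma two_qubit_0_marginal_fst:
  "two_qubit 0 0 T $ (1, i) $ (1, j) + two_qubit 0 0 T $ (2, i) $ (2, j) = mat 1 $ i $ j / 2"
proof -
  have "(\<Sum>a\<in>UNIV. \<Sum>b\<in>UNIV. of_real (T $ a $ b) * (pauli $ a $ 1 $ 1 * pauli $ b $ i $ j))
      + (\<Sum>a\<in>UNIV. \<Sum>b\<in>UNIV. of_real (T $ a $ b) * (pauli $ a $ 2 $ 2 * pauli $ b $ i $ j)) = 0"
    by (simp add: pauli_trace flip: sum.distrib distrib_left distrib_right)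
  then show ?thesis
    by (simp add: two_qubit_0_nth mat_def flip: add_divide_distrib)
qed

text \<open>This is Alice's marginal, by tracelessness of Bob's Pauli factor.\<close>

lemma two_qubit_0_marginal_snd:
  "two_qubit 0 0 T $ (k, 1) $ (l, 1) + two_qubit 0 0 T $ (k, 2) $ (l, 2) = mat 1 $ k $ l / 2"
proof -
  have "(\<Sum>a\<in>UNIV. \<Sum>b\<in>UNIV. of_real (T $ a $ b) * (pauli $ a $ k $ l * pauli $ b $ 1 $ 1))
      + (\<Sum>a\<in>UNIV. \<Sum>b\<in>UNIV. of_real (T $ a $ b) * (pauli $ a $ k $ l * pauli $ b $ 2 $ 2)) = 0"
    by (simp add: pauli_trace flip: sum.distrib distrib_left distrib_right)
  then show ?thesis
    by (simp add: two_qubit_0_nth mat_def flip: add_divide_distrib)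
qed

text \<open>Tracing out Bob leaves \<open>E\<close> paired with Alice's marginal, half the
  identity.\<close>

lemma trace_ptrace_fst_two_qubit:
  "trace (ptrace_fst (kron E (mat 1) ** two_qubit 0 0 T)) = trace E / 2"
proof -
  have "trace (ptrace_fst (kron E (mat 1) ** two_qubit 0 0 T)) = (\<Sum>k\<in>UNIV. \<Sum>l\<in>UNIV.
      E $ k $ l * (two_qubit 0 0 T $ (l, 1) $ (k, 1) + two_qubit 0 0 T $ (l, 2) $ (k, 2)))"
    by (simp add: trace_def ptrace_fst_kron_mult sum_2 algebra_simps)
  also have "\<dots> = trace E / 2"
    by (simp only: two_qubit_0_marginal_snd) (simp add: mat_def trace_def sum_2 add_divide_distrib)
  finally show ?thesis .
qed

lemma outcome_prob_two_qubit: "outcome_prob (two_qubit 0 0 T) E = Re (trace E) / 2"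
  by (simp add: outcome_prob_ptrace trace_ptrace_fst_two_qubit)

text \<open>By linearity the part \<open>mat (trace E)\<close> contributes \<open>trace E\<close>
  times Bob's marginal, that is \<open>trace E / 2\<close> times the identity. That scalar is
  exactly the trace of Bob's unnormalized state for \<open>E\<close>.\<close>

lemma ptrace_fst_spin_flip_two_qubit:
  "ptrace_fst (kron (spin_flip E) (mat 1) ** two_qubit 0 0 T) =
    spin_flip (ptrace_fst (kron E (mat 1) ** two_qubit 0 0 T))"
proof -
  have nth: "spin_flip E $ k $ l = (if k = l then trace E else 0) - E $ k $ l" for k l
    by (simp add: spin_flip_def mat_def)
  have "ptrace_fst (kron (spin_flip E) (mat 1) ** two_qubit 0 0 T) $ i $ j =
      trace E * (two_qubit 0 0 T $ (1, i) $ (1, j) + two_qubit 0 0 T $ (2, i) $ (2, j))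
      - ptrace_fst (kron E (mat 1) ** two_qubit 0 0 T) $ i $ j" for i j
    by (simp add: ptrace_fst_kron_mult nth sum_2 algebra_simps)
  then show ?thesis
    by (simp add: vec_eq_iff two_qubit_0_marginal_fst spin_flip_def[of "ptrace_fst _"]
        trace_ptrace_fst_two_qubit) (simp add: mat_def)
qed

lemma outcome_prob_spin_flip_two_qubit:
  "outcome_prob (two_qubit 0 0 T) (spin_flip E) = outcome_prob (two_qubit 0 0 T) E"
  by (simp add: outcome_prob_two_qubit trace_spin_flip)

lemma cond_state_spin_flip_two_qubit:
  "cond_state (two_qubit 0 0 T) (spin_flip E) = spin_flip (cond_state (two_qubit 0 0 T) E)"
  by (simp add: cond_state_def outcome_prob_spin_flip_two_qubit ptrace_fst_spin_flip_two_qubit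
      spin_flip_scaleR)

section \<open>Nonclassicality of conditional states and its POVM averages\<close>

lemma N_KD_cond_state_bdd:
  obtains B where "\<And>E. psd E \<Longrightarrow> 0 < outcome_prob (two_qubit 0 0 T) E \<Longrightarrow>
    N_KD n (cond_state (two_qubit 0 0 T) E) \<le> B"
proof -
  let ?\<rho> = "two_qubit 0 0 T"
  obtain K where K: "0 \<le> K" "\<And>\<rho>. N_KD n \<rho> \<le> K * norm \<rho>"
    using N_KD_le_norm by blast
  obtain L where L: "0 < L" "\<And>E. norm (ptrace_fst (kron E (mat 1) ** ?\<rho>)) \<le> L * norm E"
    using linear_bounded_pos[OF linear_ptrace_fst_kron[of ?\<rho>]] by blast
  show ?thesis
  proof (rule that)
    fix E assume E: "psd E" and p: "0 < outcome_prob ?\<rho> E"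
    have "norm (cond_state ?\<rho> E) = norm (ptrace_fst (kron E (mat 1) ** ?\<rho>)) / outcome_prob ?\<rho> E"
      using p by (simp add: cond_state_def)
    \<comment> \<open>The norm of \<open>E\<close> is at most four times its trace, and the trace is
      twice the probability; so the probability cancels.\<close>
    also have "\<dots> \<le> L * (8 * outcome_prob ?\<rho> E) / outcome_prob ?\<rho> E"
    proof (intro divide_right_mono order.trans[OF L(2)] mult_left_mono)
      show "norm E \<le> 8 * outcome_prob ?\<rho> E"
        using norm_psd_le[OF E] by (simp add: outcome_prob_two_qubit)
    qed (use L p in auto)
    also have "\<dots> = 8 * L" using p by simp
    finally have "K * norm (cond_state ?\<rho> E) \<le> K * (8 * L)"
      using K(1) by (intro mult_left_mono)
    then show "N_KD n (cond_state ?\<rho> E) \<le> K * (8 * L)"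
      using K(2) order.trans by blast
  qed
qed

definition avg_KD :: "real^3 \<Rightarrow> complex^(2 \<times> 2)^(2 \<times> 2) \<Rightarrow> nat \<Rightarrow> (nat \<Rightarrow> complex^2^2) \<Rightarrow> real" where
  "avg_KD n \<rho> m M = (\<Sum>a\<in>{a. a < m \<and> outcome_prob \<rho> (M a) > 0}.
     outcome_prob \<rho> (M a) * N_KD n (cond_state \<rho> (M a)))"

lemma avg_KD_spin_flip_povm:
  assumes "norm n = 1" "hermitian (two_qubit 0 0 T)" "psd E" "0 < outcome_prob (two_qubit 0 0 T) E"
  obtains M where "povm 2 M"
    "avg_KD n (two_qubit 0 0 T) 2 M = N_KD n (cond_state (two_qubit 0 0 T) E)"
proof
  let ?\<rho> = "two_qubit 0 0 T"
  define t where "t = Re (trace E)"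
  have t: "0 < t" and tr: "trace E = of_real t"
    using assms(4) psd_trace(2)[OF assms(3)] by (simp_all add: outcome_prob_two_qubit t_def)
  \<comment> \<open>\<open>E\<close> and its flip add up to \<open>t\<close> times the identity,
    which fixes the scale. Both elements then have trace 1, hence probability 1/2.\<close>
  define M where "M a = (1 / t) *\<^sub>R (if a = 0 then E else spin_flip E)" for a :: nat
  have "M 0 + M 1 = (1 / t) *\<^sub>R mat (of_real t)"
    by (simp add: M_def spin_flip_def tr flip: scaleR_add_right)
  also have "\<dots> = mat 1"
    using t by (simp add: vec_eq_iff mat_def scaleR_conv_of_real[where 'a=complex])
  finally have "M 0 + M 1 = mat 1" .
  moreover have "psd (M a)" for a
    using t by (auto simp: M_def intro!: psd_scaleR psd_spin_flip assms(3))
  ultimately show "povm 2 M"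
    by (simp add: povm_def lessThan_Suc numeral_2_eq_2 add.commute)
  have p: "outcome_prob ?\<rho> (M a) = 1 / 2" for a
    using t by (simp add: M_def outcome_prob_scaleR outcome_prob_spin_flip_two_qubit)
      (simp add: outcome_prob_two_qubit t_def)
  have "hermitian (cond_state ?\<rho> E)"
    using assms(2,3) by (intro hermitian_cond_state) (simp_all add: psd_def)
  then have N: "N_KD n (cond_state ?\<rho> (M a)) = N_KD n (cond_state ?\<rho> E)" for a
    using t by (simp add: M_def cond_state_scaleR cond_state_spin_flip_two_qubit
        N_KD_spin_flip[OF assms(1)])
  show "avg_KD n ?\<rho> 2 M = N_KD n (cond_state ?\<rho> E)"
    by (simp add: avg_KD_def p N)
qed

lemma avg_KD_le:
  assumes "povm m M"
    and "\<And>a. a < m \<Longrightarrow> 0 < outcome_prob (two_qubit 0 0 T) (M a) \<Longrightarrow>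
      N_KD n (cond_state (two_qubit 0 0 T) (M a)) \<le> B"
  shows "avg_KD n (two_qubit 0 0 T) m M \<le> B"
proof -
  let ?p = "\<lambda>a. outcome_prob (two_qubit 0 0 T) (M a)"
  let ?A = "{a. a < m \<and> ?p a > 0}"
  have "0 \<le> ?p a" if "a < m" for a
    using assms(1) that by (simp add: outcome_prob_two_qubit psd_trace(1) povm_def)
  \<comment> \<open>The omitted outcomes have probability exactly zero, so the remaining weights
    still sum to 1.\<close>
  then have "(\<Sum>a\<in>?A. ?p a) = (\<Sum>a<m. ?p a)"
    by (intro sum.mono_neutral_left) (auto simp: order.order_iff_strict)
  also have "\<dots> = Re (trace (\<Sum>a<m. M a)) / 2"
    by (simp add: outcome_prob_two_qubit trace_def sum_2 sum.distrib sum_divide_distrib add_divide_distrib)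
  also have "\<dots> = 1"
    using assms(1) by (simp add: povm_def trace_def mat_def)
  finally have "(\<Sum>a\<in>?A. ?p a * B) = B"
    by (simp flip: sum_distrib_right)
  moreover have "avg_KD n (two_qubit 0 0 T) m M \<le> (\<Sum>a\<in>?A. ?p a * B)"
    unfolding avg_KD_def by (intro sum_mono mult_left_mono assms(2)) auto
  ultimately show ?thesis by simp
qed

theorem proposition3:
  fixes \<rho>\<^sub>A\<^sub>B :: "complex^(2 \<times> 2)^(2 \<times> 2)"
    and a b n\<^sub>B :: "real^3"
    and T :: "real^3^3"
  assumes "density_matrix \<rho>\<^sub>A\<^sub>B"
    and "\<rho>\<^sub>A\<^sub>B = two_qubit a b T"
    and "a = 0" and "b = 0"
    and "norm n\<^sub>B = 1"
  shows "R_KD n\<^sub>B \<rho>\<^sub>A\<^sub>B = C_KD n\<^sub>B \<rho>\<^sub>A\<^sub>B"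
proof -
  have \<rho>: "\<rho>\<^sub>A\<^sub>B = two_qubit 0 0 T" and herm: "hermitian \<rho>\<^sub>A\<^sub>B"
    using assms(1-4) by (simp_all add: density_matrix_def psd_def)
  define RS where "RS = {N_KD n\<^sub>B (cond_state \<rho>\<^sub>A\<^sub>B (M a)) | m M a.
    povm m M \<and> a < m \<and> outcome_prob \<rho>\<^sub>A\<^sub>B (M a) > 0}"
  define CS where "CS = {avg_KD n\<^sub>B \<rho>\<^sub>A\<^sub>B m M | m M. povm m M}"
  have R: "R_KD n\<^sub>B \<rho>\<^sub>A\<^sub>B = Sup RS" and C: "C_KD n\<^sub>B \<rho>\<^sub>A\<^sub>B = Sup CS"
    by (simp_all add: R_KD_def C_KD_def RS_def CS_def avg_KD_def)
  obtain B where B: "\<And>E. psd E \<Longrightarrow> 0 < outcome_prob \<rho>\<^sub>A\<^sub>B E \<Longrightarrow> N_KD n\<^sub>B (cond_state \<rho>\<^sub>A\<^sub>B E) \<le> B"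
    using N_KD_cond_state_bdd[of T n\<^sub>B] unfolding \<rho> by blast
  have bdd: "bdd_above RS"
    by (rule bdd_aboveI[of _ B]) (auto simp: RS_def povm_def intro: B)
  \<comment> \<open>Every single-outcome value is itself a POVM average, by the two-outcome POVM of
    an effect and its flip.\<close>
  have RS_CS: "RS \<subseteq> CS"
  proof
    fix x assume "x \<in> RS"
    then obtain E where E: "psd E" "0 < outcome_prob \<rho>\<^sub>A\<^sub>B E" and x: "x = N_KD n\<^sub>B (cond_state \<rho>\<^sub>A\<^sub>B E)"
      by (auto simp: RS_def povm_def)
    obtain M where "povm 2 M" "avg_KD n\<^sub>B \<rho>\<^sub>A\<^sub>B 2 M = x"
      using avg_KD_spin_flip_povm[of n\<^sub>B T E] assms(5) herm E unfolding \<rho> x by blast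
    then show "x \<in> CS" by (auto simp: CS_def)
  qed
  \<comment> \<open>Used twice below: as one of the two inequalities, and as boundedness of
    \<open>CS\<close> for the other.\<close>
  have C_le: "y \<le> Sup RS" if yCS: "y \<in> CS" for y
  proof -
    obtain m M where M: "povm m M" and y: "y = avg_KD n\<^sub>B \<rho>\<^sub>A\<^sub>B m M"
      using yCS unfolding CS_def by blast
    have "N_KD n\<^sub>B (cond_state \<rho>\<^sub>A\<^sub>B (M a)) \<le> Sup RS" if "a < m" "0 < outcome_prob \<rho>\<^sub>A\<^sub>B (M a)" for a
      using M that by (intro cSup_upper bdd) (auto simp: RS_def)
    then show ?thesis
      unfolding y \<rho> by (rule avg_KD_le[OF M])
  qed
  have "hermitian (mat 1 :: complex^2^2)"
    by (simp add: hermitian_def dagger_def vec_eq_iff mat_def)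
  then have "psd (mat 1 :: complex^2^2)"
    by (simp add: psd_def cinner_def sum_2)
  \<comment> \<open>The trivial measurement, with its sure outcome, shows that \<open>RS\<close> is
    nonempty.\<close>
  then have "povm 1 (\<lambda>_. mat 1)" by (simp add: povm_def)
  moreover have "0 < outcome_prob \<rho>\<^sub>A\<^sub>B (mat 1)"
    by (simp add: \<rho> outcome_prob_two_qubit trace_def mat_def)
  ultimately have "N_KD n\<^sub>B (cond_state \<rho>\<^sub>A\<^sub>B (mat 1)) \<in> RS"
    unfolding RS_def mem_Collect_eq
    by (intro exI[of _ "1::nat"] exI[of _ "\<lambda>_. mat 1"] exI[of _ "0::nat"]) simp
  then have ne: "RS \<noteq> {}" by blast
  show ?thesis
    unfolding R C
  proof (rule antisym)
    show "Sup RS \<le> Sup CS"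
      using C_le by (intro cSup_subset_mono ne RS_CS bdd_aboveI)
    show "Sup CS \<le> Sup RS"
      using ne RS_CS C_le by (intro cSup_least) auto
  qed
qed

end
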